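(* Let $(S_i,v_i)$ be a normed semigroup and $\phi_i:S_i\to S_i$ an endomorphism for $i=1,2$. Then the endomorphism $\phi=\phi_1\times\phi_2$ of $(S,v)=(S_1\times S_2,v_\Pi)$ has $h_{\mathfrak S}(\phi)=\max\{h_{\mathfrak S}(\phi_1),h_{\mathfrak S}(\phi_2)\}$.
   Context: A normed semigroup $(S,v)$ is a semigroup $(S,\cdot)$ with an arbitrary function $v:S\to\mathbb R_{\ge0}$. Endomorphisms are contractive semigroup endomorphisms: $v(\phi(x))\le v(x)$ for all $x$. On the direct product $S_1\times S_2$ the max-norm is $v_\Pi(x_1,x_2)=\max\{v_1(x_1),v_2(x_2)\}$. For $x\in S$, $T_n(\phi,x)=x\cdot\phi(x)\cdots\phi^{n-1}(x)$, $h_{\mathfrak S}(\phi,x)=\limsup_{n\to\infty}\frac{v(T_n(\phi,x))}{n}$, and $h_{\mathfrak S}(\phi)=\sup_{x\in S}h_{\mathfrak S}(\phi,x)\in[0,\infty]$. *)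

theory Defs
  imports
    "HOL-Library.Extended_Nonnegative_Real"
    "HOL-Algebra.Congruence"
begin

record 'a nsemigroup = "'a partial_object" +
  op :: "'a \<Rightarrow> 'a \<Rightarrow> 'a" (infixl \<open>\<cdot>\<index>\<close> 70)
  nrm :: "'a \<Rightarrow> real"

text \<open>Semigroups are nonempty, as usual; the max formula for products below would fail
  for an empty factor. The norm is an arbitrary nonnegative function.\<close>

locale normed_semigroup =
  fixes S (structure)
  assumes nonempty: "carrier S \<noteq> {}"
    and closed: "x \<in> carrier S \<Longrightarrow> y \<in> carrier S \<Longrightarrow> x \<cdot> y \<in> carrier S"
    and assoc: "x \<in> carrier S \<Longrightarrow> y \<in> carrier S \<Longrightarrow> z \<in> carrier S \<Longrightarrow>
      (x \<cdot> y) \<cdot> z = x \<cdot> (y \<cdot> z)"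
    and nrm_nonneg: "x \<in> carrier S \<Longrightarrow> 0 \<le> nrm S x"

definition endomorphism :: "'a nsemigroup \<Rightarrow> ('a \<Rightarrow> 'a) \<Rightarrow> bool" where
  "endomorphism S \<phi> \<longleftrightarrow>
     \<phi> \<in> carrier S \<rightarrow> carrier S \<and>
     (\<forall>x\<in>carrier S. \<forall>y\<in>carrier S. \<phi> (x \<cdot>\<^bsub>S\<^esub> y) = \<phi> x \<cdot>\<^bsub>S\<^esub> \<phi> y) \<and>
     (\<forall>x\<in>carrier S. nrm S (\<phi> x) \<le> nrm S x)"

definition prod_nsemigroup :: "'a nsemigroup \<Rightarrow> 'b nsemigroup \<Rightarrow> ('a \<times> 'b) nsemigroup" where
  "prod_nsemigroup S1 S2 =
     \<lparr>carrier = carrier S1 \<times> carrier S2,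
      op = (\<lambda>(x1, x2) (y1, y2). (x1 \<cdot>\<^bsub>S1\<^esub> y1, x2 \<cdot>\<^bsub>S2\<^esub> y2)),
      nrm = (\<lambda>(x1, x2). max (nrm S1 x1) (nrm S2 x2))\<rparr>"

text \<open>The trajectory is meaningful for positive \<open>n\<close>; a semigroup has no empty product,
  and the value at \<open>n = 0\<close> (which is \<open>x\<close>) is irrelevant for the limit superior.\<close>

definition trajectory :: "'a nsemigroup \<Rightarrow> ('a \<Rightarrow> 'a) \<Rightarrow> nat \<Rightarrow> 'a \<Rightarrow> 'a" where
  "trajectory S \<phi> n x = foldl (op S) x (map (\<lambda>k. (\<phi> ^^ k) x) [1..<n])"

definition entropy_at :: "'a nsemigroup \<Rightarrow> ('a \<Rightarrow> 'a) \<Rightarrow> 'a \<Rightarrow> ennreal" where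
  "entropy_at S \<phi> x = limsup (\<lambda>n. ennreal (nrm S (trajectory S \<phi> n x) / real n))"

definition entropy :: "'a nsemigroup \<Rightarrow> ('a \<Rightarrow> 'a) \<Rightarrow> ennreal" where
  "entropy S \<phi> = (SUP x\<in>carrier S. entropy_at S \<phi> x)"

lemma trajectory_1: "trajectory S \<phi> 1 x = x"
  by (simp add: trajectory_def)

lemma trajectory_Suc:
  "n \<ge> 1 \<Longrightarrow> trajectory S \<phi> (Suc n) x = trajectory S \<phi> n x \<cdot>\<^bsub>S\<^esub> (\<phi> ^^ n) x"
  by (simp add: trajectory_def)

lemma normed_semigroup_prod:
  assumes "normed_semigroup S1" and "normed_semigroup S2"
  shows "normed_semigroup (prod_nsemigroup S1 S2)"
  using assms unfolding normed_semigroup_def prod_nsemigroup_def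
  by (auto simp: le_max_iff_disj)

lemma endomorphism_prod:
  assumes "endomorphism S1 \<phi>1" and "endomorphism S2 \<phi>2"
  shows "endomorphism (prod_nsemigroup S1 S2) (map_prod \<phi>1 \<phi>2)"
  using assms unfolding endomorphism_def prod_nsemigroup_def
  by (auto simp: Pi_iff simp del: max.bounded_iff intro!: max.mono)

end

theory Submission
  imports Defs
begin

text \<open>Products in the product semigroup are formed componentwise, so by
  \<open>trajectory_prod\<close> the norm of a trajectory is the max of the norms of its two
  components. Division by n and, by \<open>Limsup_max\<close>, the limit superior commute with
  binary max; this gives the formula at each point, \<open>entropy_at_prod\<close>. Taking suprema
  over pairs keeps the max, because each carrier is nonempty and so every point of one factor
  extends to a pair.\<close>

lemma Limsup_max:
  fixes f g :: "'a \<Rightarrow> 'b :: complete_linorder"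
  shows "Limsup F (\<lambda>x. max (f x) (g x)) = max (Limsup F f) (Limsup F g)"
proof (rule antisym)
  show "Limsup F (\<lambda>x. max (f x) (g x)) \<le> max (Limsup F f) (Limsup F g)"
    \<comment> \<open>A bound on a limsup amounts to eventual strict bounds by every larger y, and
      two eventual bounds can be conjoined.\<close>
    unfolding Limsup_le_iff
  proof (intro allI impI)
    fix y assume "max (Limsup F f) (Limsup F g) < y"
    then have "\<forall>\<^sub>F x in F. f x < y" "\<forall>\<^sub>F x in F. g x < y"
      by (auto intro: Limsup_lessD)
    then show "\<forall>\<^sub>F x in F. max (f x) (g x) < y"
      by eventually_elim simp
  qed
  show "max (Limsup F f) (Limsup F g) \<le> Limsup F (\<lambda>x. max (f x) (g x))"
    by (auto intro!: Limsup_mono)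
qed

lemma trajectory_prod:
  "trajectory (prod_nsemigroup S1 S2) (map_prod \<phi>1 \<phi>2) n (x1, x2) =
    (trajectory S1 \<phi>1 n x1, trajectory S2 \<phi>2 n x2)"
proof -
  have funpow: "(map_prod \<phi>1 \<phi>2 ^^ k) (x1, x2) = ((\<phi>1 ^^ k) x1, (\<phi>2 ^^ k) x2)" for k
    by (induction k) auto
  \<comment> \<open>The starting values are general because each step of \<open>foldl\<close>
    changes the accumulator.\<close>
  have "foldl (op (prod_nsemigroup S1 S2)) (y1, y2)
      (map (\<lambda>k. (map_prod \<phi>1 \<phi>2 ^^ k) (x1, x2)) ks) =
    (foldl (op S1) y1 (map (\<lambda>k. (\<phi>1 ^^ k) x1) ks),
     foldl (op S2) y2 (map (\<lambda>k. (\<phi>2 ^^ k) x2) ks))" for y1 y2 ks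
    by (induction ks arbitrary: y1 y2) (simp_all add: funpow prod_nsemigroup_def)
  then show ?thesis
    by (simp add: trajectory_def)
qed

lemma entropy_at_prod:
  "entropy_at (prod_nsemigroup S1 S2) (map_prod \<phi>1 \<phi>2) (x1, x2) =
    max (entropy_at S1 \<phi>1 x1) (entropy_at S2 \<phi>2 x2)"
proof -
  \<comment> \<open>Division by \<open>real n\<close> \<ge> 0 and \<open>ennreal\<close> are
    monotone, hence preserve max; at n = 0 both quotients are 0.\<close>
  have "ennreal (max a b / real n) = max (ennreal (a / real n)) (ennreal (b / real n))"
    for a b n
    by (simp add: max_divide_distrib_right max_of_mono [symmetric] mono_def ennreal_leI)
  then show ?thesis
    unfolding entropy_at_def trajectory_prod
    by (simp add: prod_nsemigroup_def Limsup_max)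
qed

theorem theorem3p12:
  fixes S1 :: "'a nsemigroup" and S2 :: "'b nsemigroup"
    and \<phi>1 :: "'a \<Rightarrow> 'a" and \<phi>2 :: "'b \<Rightarrow> 'b"
  assumes "normed_semigroup S1" and "normed_semigroup S2"
    and "endomorphism S1 \<phi>1" and "endomorphism S2 \<phi>2"
  shows "entropy (prod_nsemigroup S1 S2) (map_prod \<phi>1 \<phi>2) =
    max (entropy S1 \<phi>1) (entropy S2 \<phi>2)"
proof (rule antisym)
  have carrier: "carrier (prod_nsemigroup S1 S2) = carrier S1 \<times> carrier S2"
    by (simp add: prod_nsemigroup_def)
  show "entropy (prod_nsemigroup S1 S2) (map_prod \<phi>1 \<phi>2) \<le>
      max (entropy S1 \<phi>1) (entropy S2 \<phi>2)"
    unfolding entropy_def carrier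
    by (rule SUP_least) (auto simp: entropy_at_prod simp del: max.bounded_iff
        intro!: max.mono SUP_upper)
  \<comment> \<open>These fixed points of the carriers serve as partners: x1 is completed to
    \<open>(x1, z2)\<close> and x2 to \<open>(z1, x2)\<close>, whose entropy dominates that of the
    given component.\<close>
  obtain z1 z2 where z: "z1 \<in> carrier S1" "z2 \<in> carrier S2"
    using assms(1,2) by (auto simp: normed_semigroup_def)
  have le: "max (entropy_at S1 \<phi>1 x1) (entropy_at S2 \<phi>2 x2) \<le>
      entropy (prod_nsemigroup S1 S2) (map_prod \<phi>1 \<phi>2)"
    if "x1 \<in> carrier S1" "x2 \<in> carrier S2" for x1 x2
    unfolding entropy_def carrier entropy_at_prod [symmetric]
    using that by (intro SUP_upper) simp
  have "entropy S1 \<phi>1 \<le> entropy (prod_nsemigroup S1 S2) (map_prod \<phi>1 \<phi>2)"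
    unfolding entropy_def [of S1] using le z(2) by (auto intro!: SUP_least)
  moreover have "entropy S2 \<phi>2 \<le> entropy (prod_nsemigroup S1 S2) (map_prod \<phi>1 \<phi>2)"
    unfolding entropy_def [of S2] using le z(1) by (auto intro!: SUP_least)
  ultimately show "max (entropy S1 \<phi>1) (entropy S2 \<phi>2) \<le>
      entropy (prod_nsemigroup S1 S2) (map_prod \<phi>1 \<phi>2)"
    by simp
qed

end
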